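(* Assume the separable-domain, separable-operator and separable-architecture setting described in the context, on the tensor-product collocation grid. For every $s=1,\dots,d$ the following holds. (i) For each $\beta=1,\dots,R_{\mathcal A}$ and $a_s=1,\dots,k_s$ define the inactive contraction $$e_{s,\beta,a_s}(i_{-s}):=\sum_{a_{-s}}c_{a_1\ldots a_d}\prod_{m\ne s}(\mathcal A_m^{(\beta)}w_m^{a_m})(z_{m,i_m}),$$ the tensor $\mathcal E_s^{(\beta)}(i_{-s},a_s):=e_{s,\beta,a_s}(i_{-s})$, and the matrix $\mathsf E_s^{(\beta)}\in\mathbb R^{N_{-s}\times k_s}$ whose columns are $\mathsf E_s^{(\beta)}(:,a_s):=\operatorname{vec}(\mathcal E_s^{(\beta)}(:,\dots,:,a_s))$ (lexicographic vectorization). Its entries are $\mathsf E_s^{(\beta)}(\overline{i_{-s}},a_s)=e_{s,\beta,a_s}(i_{-s})$. (ii) The corresponding local residual sensitivity matrix is $\mathsf C_s^{(\beta)}\in\mathbb R^{n_sk_s\times P_s}$, $\ \mathsf C_s^{(\beta)}(\overline{i_sa_s},j):=(\mathcal A_s^{(\beta)}\partial_{\theta^s_j}w_s^{a_s})(z_{s,i_s})$. (iii) Define $\Psi_s^{(\beta)}\in\mathbb R^{N_{\mathcal D}\times n_sk_s}$ by $\Psi_s^{(\beta)}(i,\overline{j_sa_s}):=\delta_{i_sj_s}\,\mathsf E_s^{(\beta)}(\overline{i_{-s}},a_s)$ for $i=\overline{i_1\ldots i_d}$, and set, with $N_s:=R_{\mathcal A}n_sk_s$, $$\Psi_s:=\big[\Psi_s^{(1)}\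 \cdots\ \Psi_s^{(R_{\mathcal A})}\big]\in\mathbb R^{N_{\mathcal D}\times N_s},\qquad \mathsf C_s:=\begin{bmatrix}\mathsf C_s^{(1)}\\ \vdots\\ \mathsf C_s^{(R_{\mathcal A})}\end{bmatrix}\in\mathbb R^{N_s\times P_s}.$$ Then the collocated Jacobian block $\mathrm J_s\in\mathbb R^{N_{\mathcal D}\times P_s}$, $\mathrm J_s(i,j)=(\mathcal A\partial_{\theta^s_j}u_\theta)(z_i)$, admits the factorization $\mathrm J_s=\Psi_s\mathsf C_s$.
   Context: Domain: $d=d_x+d_\xi$; $\Omega=\mathcal D_1\times\cdots\times\mathcal D_{d_x}$, $\Xi=\mathcal D_{d_x+1}\times\cdots\times\mathcal D_d$, $\mathcal D=\Omega\times\Xi$, where $\mathcal D_m=(z_m^-,z_m^+)\subset\mathbb R$ are bounded open intervals. $L^2(\mathcal D)$ is identified with $\bigotimes_m L^2(\mathcal D_m)$; $v_1\otimes\cdots\otimes v_d$ is the function $\prod_m v_m(z_m)$. Operator: $V$ is a Hilbert space of functions on $\Omega$ with bounded trace $V\to L^2(\partial\Omega)$, $U=L^2(\Xi;V)$, $\mathcal A:U\to L^2(\mathcal D)$ bounded linear. There are Hilbert spaces $H_m\hookrightarrow L^2(\mathcal D_m)$ such that $H=H_1\otimes\cdots\otimes H_d$ (Hilbert tensor product) satisfies $\|v_1\otimes\cdots\otimes v_d\|_H=\prod_m\|v_m\|_{H_m}$, is continuously and densely embedded in $U$, and $\mathcal A|_H=\sum_{\beta=1}^{R_{\mathcal A}}\mathcal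 A_1^{(\beta)}\otimes\cdots\otimes\mathcal A_d^{(\beta)}$ with bounded linear $\mathcal A_m^{(\beta)}:H_m\to L^2(\mathcal D_m)$. Architecture: $\theta=(\theta^1,\dots,\theta^d)$, $\theta^m\in\mathbb R^{P_m}$; differentiable maps $\mathbb R^{P_m}\to H_m^{k_m}$, $\theta^m\mapsto(w_m^1,\dots,w_m^{k_m})$; a fixed array $c\in\mathbb R^{k_1\times\cdots\times k_d}$; $u_\theta=\sum_{a_1,\dots,a_d}c_{a_1\ldots a_d}\,w_1^{a_1}\otimes\cdots\otimes w_d^{a_d}\in H$. Index convention: $\overline{i_1\ldots i_k}=i_k+(i_{k-1}-1)n_k+\cdots+(i_1-1)n_2\cdots n_k$ (lexicographic position, leftmost index slowest). $i_{-s}$ and $a_{-s}$ denote $(i_1,\dots,i_d)$ and $(a_1,\dots,a_d)$ with the $s$-th entry removed; $\sum_{a_{-s}}$ runs over $1\le a_m\le k_m$, $m\ne s$. Collocation: $\mathcal X_m=\{z_{m,1},\dots,z_{m,n_m}\}\subset\mathcal D_m$, $N_{\mathcal D}=\prod_mn_m$, $N_{-s}=\prod_{m\ne s}n_m$, and $z_i=(z_{1,i_1},\dots,z_{d,i_d})$ for $i=\overline{i_1\ldots i_d}$. The functions $\mathcal A_m^{(\beta)}w_m^{a}$ and $\mathcal A_m^{(\beta)}\partial_{\theta^m_j}w_m^{a}$ are assumed to have continuous representatives on $\overline{\mathcal D_m}$, which define the point values. *)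

theory Defs
  imports "HOL-Analysis.Analysis" "HOL-Probability.Giry_Monad" "Jordan_Normal_Form.Matrix"
begin

text \<open>
  Conventions. All indices start at 0, as in the matrix library: directions \<open>m < d\<close>, terms
  \<open>\<beta> < R\<close>, components \<open>a < k m\<close>, grid indices \<open>i m < n m\<close>, parameters \<open>j < P m\<close>.
  Points of a box and multi-indices are functions on the (finite) set of directions, extensional
  in the sense of \<open>PiE\<close>.
  Elements of an \<open>L\<^sup>2\<close> space are represented by functions, and equality there is equality almost
  everywhere.
\<close>

section \<open>Square-integrable functions\<close>

text \<open>Strong (Bochner) measurability, so that \<open>L2_space M\<close> is the Bochner space also for a
  value space that is not assumed separable. On real functions it is Borel measurability.\<close>

definition strongly_measurable :: "'a measure \<Rightarrow> ('a \<Rightarrow> 'b::real_normed_vector) \<Rightarrow> bool" where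
  "strongly_measurable M f \<longleftrightarrow>
     (\<exists>s. (\<forall>i. simple_function M (s i)) \<and> (\<forall>x\<in>space M. (\<lambda>i::nat. s i x) \<longlonglongrightarrow> f x))"

definition L2_space :: "'a measure \<Rightarrow> ('a \<Rightarrow> 'b::real_normed_vector) set" where
  "L2_space M = {f. strongly_measurable M f \<and> integrable M (\<lambda>x. (norm (f x))\<^sup>2)}"

definition L2_norm :: "'a measure \<Rightarrow> ('a \<Rightarrow> 'b::real_normed_vector) \<Rightarrow> real" where
  "L2_norm M f = sqrt (\<integral>x. (norm (f x))\<^sup>2 \<partial>M)"

text \<open>Bounded linear maps from \<open>X\<close> to \<open>L\<^sup>2(M)\<close>. The operations and the (semi)norm of the source are
  arguments, since the source may itself be an \<open>L\<^sup>2\<close> space. In that case linearity and boundedness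
  force \<open>T\<close> to send functions that agree almost everywhere to functions that agree almost
  everywhere.\<close>

definition bounded_linear_to_L2 ::
  "'x set \<Rightarrow> ('x \<Rightarrow> 'x \<Rightarrow> 'x) \<Rightarrow> (real \<Rightarrow> 'x \<Rightarrow> 'x) \<Rightarrow> ('x \<Rightarrow> real) \<Rightarrow> 'a measure
     \<Rightarrow> ('x \<Rightarrow> 'a \<Rightarrow> 'b::real_normed_vector) \<Rightarrow> bool" where
  "bounded_linear_to_L2 X pls scl nrm M T \<longleftrightarrow>
     (\<forall>x\<in>X. T x \<in> L2_space M) \<and>
     (\<forall>x\<in>X. \<forall>y\<in>X. AE t in M. T (pls x y) t = T x t + T y t) \<and>
     (\<forall>r. \<forall>x\<in>X. AE t in M. T (scl r x) t = r *\<^sub>R T x t) \<and>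
     (\<exists>C. \<forall>x\<in>X. L2_norm M (T x) \<le> C * nrm x)"

abbreviation bounded_operator ::
  "'h::real_normed_vector set \<Rightarrow> 'a measure \<Rightarrow> ('h \<Rightarrow> 'a \<Rightarrow> 'b::real_normed_vector) \<Rightarrow> bool" where
  "bounded_operator X M T \<equiv> bounded_linear_to_L2 X (+) (*\<^sub>R) norm M T"

abbreviation bounded_operator_L2 ::
  "'c measure \<Rightarrow> 'a measure \<Rightarrow> (('c \<Rightarrow> 'v::real_normed_vector) \<Rightarrow> 'a \<Rightarrow> 'b::real_normed_vector) \<Rightarrow> bool"
where
  "bounded_operator_L2 N M T \<equiv>
     bounded_linear_to_L2 (L2_space N) (\<lambda>u v x. u x + v x) (\<lambda>r u x. r *\<^sub>R u x) (L2_norm N) M T"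

definition continuously_embedded ::
  "'h::real_normed_vector set \<Rightarrow> 'a measure \<Rightarrow> ('h \<Rightarrow> 'a \<Rightarrow> 'b::real_normed_vector) \<Rightarrow> bool" where
  "continuously_embedded X M J \<longleftrightarrow>
     bounded_operator X M J \<and> (\<forall>x\<in>X. (AE t in M. J x t = 0) \<longrightarrow> x = 0)"

definition is_cont_rep ::
  "'a::topological_space measure \<Rightarrow> 'a set \<Rightarrow> ('a \<Rightarrow> real) \<Rightarrow> ('a \<Rightarrow> real) \<Rightarrow> bool" where
  "is_cont_rep M K f g \<longleftrightarrow> continuous_on K g \<and> (AE t in M. f t = g t)"

text \<open>The value at \<open>x \<in> K\<close> of the continuous representative on \<open>K\<close>. It is used for a bounded open
  box with its Lebesgue measure and \<open>K\<close> the closed box, where the representative is unique on \<open>K\<close>.\<close>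

definition point_value ::
  "'a::topological_space measure \<Rightarrow> 'a set \<Rightarrow> ('a \<Rightarrow> real) \<Rightarrow> 'a \<Rightarrow> real" where
  "point_value M K f x = (SOME g. is_cont_rep M K f g) x"


section \<open>Hilbert tensor products and differentiability\<close>

text \<open>\<open>tens v\<close> is the elementary tensor of \<open>v 0, \<dots>, v (d - 1)\<close>; the complete space \<open>'t\<close> is the closed
  linear span of the elementary tensors.\<close>

definition hilbert_tensor_product ::
  "nat \<Rightarrow> (nat \<Rightarrow> 'h::real_inner set) \<Rightarrow> ((nat \<Rightarrow> 'h) \<Rightarrow> 't::{real_inner,complete_space}) \<Rightarrow> bool" where
  "hilbert_tensor_product d Hs tens \<longleftrightarrow>
     (\<forall>v\<in>Pi {..<d} Hs. \<forall>m<d. \<forall>x\<in>Hs m. \<forall>y\<in>Hs m.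
        tens (v(m := x + y)) = tens (v(m := x)) + tens (v(m := y))) \<and>
     (\<forall>v\<in>Pi {..<d} Hs. \<forall>m<d. \<forall>r. \<forall>x\<in>Hs m. tens (v(m := r *\<^sub>R x)) = r *\<^sub>R tens (v(m := x))) \<and>
     (\<forall>v\<in>Pi {..<d} Hs. \<forall>w\<in>Pi {..<d} Hs. inner (tens v) (tens w) = (\<Prod>m<d. inner (v m) (w m))) \<and>
     closure (span (tens ` Pi {..<d} Hs)) = UNIV"

text \<open>\<open>T\<close> is the tensor product of the operators \<open>A m\<close>: bounded linear and given on elementary
  tensors by the product of the images, where \<open>L\<^sup>2\<close> of the product measure plays the role of the
  tensor product of the target spaces. By density such a \<open>T\<close> is unique up to null sets.\<close>

definition operator_tensor_product ::
  "nat \<Rightarrow> (nat \<Rightarrow> 'h::real_inner set) \<Rightarrow> ((nat \<Rightarrow> 'h) \<Rightarrow> 't::{real_inner,complete_space})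
     \<Rightarrow> (nat \<Rightarrow> real measure) \<Rightarrow> (nat \<Rightarrow> 'h \<Rightarrow> real \<Rightarrow> real)
     \<Rightarrow> ('t \<Rightarrow> (nat \<Rightarrow> real) \<Rightarrow> real) \<Rightarrow> bool" where
  "operator_tensor_product d Hs tens M A T \<longleftrightarrow>
     bounded_operator UNIV (PiM {..<d} M) T \<and>
     (\<forall>v\<in>Pi {..<d} Hs. AE z in PiM {..<d} M. T (tens v) z = (\<Prod>m<d. A m (v m) (z m)))"

text \<open>\<open>\<real>\<^sup>P\<close> for a number \<open>P\<close>; the library function \<open>L2_set\<close> is its Euclidean norm.\<close>

definition euclid :: "nat \<Rightarrow> (nat \<Rightarrow> real) set" where
  "euclid P = {..<P} \<rightarrow>\<^sub>E UNIV"

text \<open>Frechet differentiability on \<open>\<real>\<^sup>P\<close>; \<open>g j\<close> is the value of the derivative on the \<open>j\<close>-th unit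
  vector.\<close>

definition frechet_differentiable ::
  "nat \<Rightarrow> ((nat \<Rightarrow> real) \<Rightarrow> 'h::real_normed_vector) \<Rightarrow> (nat \<Rightarrow> real) \<Rightarrow> bool" where
  "frechet_differentiable P f x \<longleftrightarrow>
     (\<exists>g. \<forall>\<epsilon>>0. \<exists>\<delta>>0. \<forall>y\<in>euclid P. L2_set (\<lambda>j. y j - x j) {..<P} < \<delta> \<longrightarrow>
        norm (f y - f x - (\<Sum>j<P. (y j - x j) *\<^sub>R g j)) \<le> \<epsilon> * L2_set (\<lambda>j. y j - x j) {..<P})"

definition partial_deriv ::
  "nat \<Rightarrow> ((nat \<Rightarrow> real) \<Rightarrow> 'h::real_normed_vector) \<Rightarrow> (nat \<Rightarrow> real) \<Rightarrow> 'h" where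
  "partial_deriv j f x = vector_derivative (\<lambda>t. f (x(j := t))) (at (x j))"


section \<open>Multi-indices\<close>

definition multi_indices :: "nat set \<Rightarrow> (nat \<Rightarrow> nat) \<Rightarrow> (nat \<Rightarrow> nat) set" where
  "multi_indices I n = (\<Pi>\<^sub>E m\<in>I. {..<n m})"

text \<open>Lexicographic position, the leftmost index varying slowest. The two-index position of
  \<open>(i, a)\<close> with \<open>a < k\<close> is the special case \<open>i * k + a\<close>.\<close>

definition lex_pos :: "nat set \<Rightarrow> (nat \<Rightarrow> nat) \<Rightarrow> (nat \<Rightarrow> nat) \<Rightarrow> nat" where
  "lex_pos I n i = (\<Sum>m\<in>I. i m * (\<Prod>l\<in>{l\<in>I. m < l}. n l))"

definition lex_index :: "nat set \<Rightarrow> (nat \<Rightarrow> nat) \<Rightarrow> nat \<Rightarrow> (nat \<Rightarrow> nat)" where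
  "lex_index I n = the_inv_into (multi_indices I n) (lex_pos I n)"

definition lex_vec :: "nat set \<Rightarrow> (nat \<Rightarrow> nat) \<Rightarrow> ((nat \<Rightarrow> nat) \<Rightarrow> real) \<Rightarrow> real Matrix.vec" where
  "lex_vec I n T = Matrix.vec (\<Prod>m\<in>I. n m) (\<lambda>p. T (lex_index I n p))"


section \<open>The separable collocation problem\<close>

text \<open>
  Points of the physical box \<open>\<Omega>\<close> have coordinates \<open>{..<dimx}\<close>, points of the parameter box \<open>\<Xi>\<close>
  coordinates \<open>{dimx..<dimx+dimxi}\<close>. The elements of the abstract Hilbert spaces are interpreted as
  functions by \<open>fnV\<close> (the space \<open>V\<close>, type \<open>'v\<close>), \<open>fnH m\<close> (the space \<open>H\<^sub>m\<close>) and \<open>emb\<close>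
  (the tensor product, type \<open>'t\<close>, inside \<open>L\<^sup>2(\<Xi>;V)\<close>).
  The finitely many Hilbert spaces \<open>H\<^sub>m\<close> are given as closed subspaces \<open>spc m\<close> of one Hilbert space
  \<open>'h\<close>; this is no restriction, because \<open>'h\<close> can be their direct sum.
  \<open>wfun m a\<close> is the feature map \<open>\<theta>\<^sup>m \<mapsto> w\<^sub>m\<^sup>a\<close>, and \<open>pnt m i\<close> is the grid point \<open>z\<^sub>m\<^sub>,\<^sub>i\<close>.
\<close>

record ('v, 'h, 't) separable_problem =
  dimx :: nat
  dimxi :: nat
  lo :: "nat \<Rightarrow> real"
  hi :: "nat \<Rightarrow> real"
  fnV :: "'v \<Rightarrow> (nat \<Rightarrow> real) \<Rightarrow> real"
  opA :: "((nat \<Rightarrow> real) \<Rightarrow> 'v) \<Rightarrow> (nat \<Rightarrow> real) \<Rightarrow> real"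
  spc :: "nat \<Rightarrow> 'h set"
  fnH :: "nat \<Rightarrow> 'h \<Rightarrow> real \<Rightarrow> real"
  tens :: "(nat \<Rightarrow> 'h) \<Rightarrow> 't"
  emb :: "'t \<Rightarrow> (nat \<Rightarrow> real) \<Rightarrow> 'v"
  rankA :: nat
  facA :: "nat \<Rightarrow> nat \<Rightarrow> 'h \<Rightarrow> real \<Rightarrow> real"
  npar :: "nat \<Rightarrow> nat"
  ncomp :: "nat \<Rightarrow> nat"
  wfun :: "nat \<Rightarrow> nat \<Rightarrow> (nat \<Rightarrow> real) \<Rightarrow> 'h"
  coef :: "(nat \<Rightarrow> nat) \<Rightarrow> real"
  npnt :: "nat \<Rightarrow> nat"
  pnt :: "nat \<Rightarrow> nat \<Rightarrow> real"

definition dims :: "('v, 'h, 't) separable_problem \<Rightarrow> nat" where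
  "dims S = dimx S + dimxi S"

definition ivl :: "('v, 'h, 't) separable_problem \<Rightarrow> nat \<Rightarrow> real measure" where
  "ivl S m = restrict_space lborel {lo S m<..<hi S m}"

definition box_measure :: "('v, 'h, 't) separable_problem \<Rightarrow> nat set \<Rightarrow> (nat \<Rightarrow> real) measure" where
  "box_measure S I = PiM I (ivl S)"

definition closed_box :: "('v, 'h, 't) separable_problem \<Rightarrow> nat set \<Rightarrow> (nat \<Rightarrow> real) set" where
  "closed_box S I = (\<Pi>\<^sub>E m\<in>I. {lo S m..hi S m})"

definition Omega :: "('v, 'h, 't) separable_problem \<Rightarrow> (nat \<Rightarrow> real) measure" where
  "Omega S = box_measure S {..<dimx S}"

definition Xi :: "('v, 'h, 't) separable_problem \<Rightarrow> (nat \<Rightarrow> real) measure" where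
  "Xi S = box_measure S {dimx S..<dims S}"

definition Dom :: "('v, 'h, 't) separable_problem \<Rightarrow> (nat \<Rightarrow> real) measure" where
  "Dom S = box_measure S {..<dims S}"

text \<open>Surface measure on the boundary of \<open>\<Omega>\<close>: the sum, over the faces \<open>x\<^sub>m = e\<close> with
  \<open>e \<in> {lo m, hi m}\<close>, of the Lebesgue measure of dimension \<open>dimx - 1\<close> on the face.\<close>

definition boundary :: "('v, 'h, 't) separable_problem \<Rightarrow> (nat \<Rightarrow> real) measure" where
  "boundary S = measure_of (space (PiM {..<dimx S} (\<lambda>_. borel :: real measure)))
     (sets (PiM {..<dimx S} (\<lambda>_. borel :: real measure)))
     (\<lambda>X. \<Sum>m<dimx S. \<Sum>e\<in>{lo S m, hi S m}.
        emeasure (PiM {..<dimx S} (\<lambda>l. if l = m then return borel e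
                                      else density lborel (indicator {lo S l<..<hi S l}))) X)"

definition separable_domain :: "('v, 'h, 't) separable_problem \<Rightarrow> bool" where
  "separable_domain S \<longleftrightarrow> (\<forall>m<dims S. lo S m < hi S m)"

definition function_space_V :: "('v::{real_inner,complete_space}, 'h, 't) separable_problem \<Rightarrow> bool" where
  "function_space_V S \<longleftrightarrow>
     (\<forall>v. fnV S v \<in> borel_measurable (Omega S)) \<and>
     (\<forall>v v'. AE x in Omega S. fnV S (v + v') x = fnV S v x + fnV S v' x) \<and>
     (\<forall>r v. AE x in Omega S. fnV S (r *\<^sub>R v) x = r * fnV S v x) \<and>
     (\<forall>v. (AE x in Omega S. fnV S v x = 0) \<longrightarrow> v = 0)"

text \<open>A bounded trace operator restricts functions that are continuous up to the boundary.\<close>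

definition bounded_trace_V :: "('v::{real_inner,complete_space}, 'h, 't) separable_problem \<Rightarrow> bool" where
  "bounded_trace_V S \<longleftrightarrow>
     (\<exists>\<gamma>. bounded_operator UNIV (boundary S) (\<gamma> :: 'v \<Rightarrow> (nat \<Rightarrow> real) \<Rightarrow> real) \<and>
        (\<forall>v g. is_cont_rep (Omega S) (closed_box S {..<dimx S}) (fnV S v) g \<longrightarrow>
           (AE x in boundary S. \<gamma> v x = g x)))"

text \<open>Density of \<open>H\<close> in \<open>U\<close> is stated through \<open>emb\<close>. The condition involving \<open>merge\<close> makes \<open>emb\<close>
  compatible with functions: the elementary tensor of \<open>v\<close> is the function
  \<open>z = (x, \<xi>) \<mapsto> \<Prod>\<^sub>m v\<^sub>m(z\<^sub>m)\<close>. The restriction of \<open>\<A>\<close> to \<open>H\<close> is \<open>\<lambda>h. opA S (emb S h)\<close>.\<close>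

definition separable_operator ::
  "('v::{real_inner,complete_space}, 'h::{real_inner,complete_space},
    't::{real_inner,complete_space}) separable_problem \<Rightarrow> bool" where
  "separable_operator S \<longleftrightarrow>
     function_space_V S \<and> bounded_trace_V S \<and>
     bounded_operator_L2 (Xi S) (Dom S) (opA S) \<and>
     (\<forall>m<dims S. subspace (spc S m) \<and> closed (spc S m) \<and>
        continuously_embedded (spc S m) (ivl S m) (fnH S m)) \<and>
     hilbert_tensor_product (dims S) (spc S) (tens S) \<and>
     continuously_embedded UNIV (Xi S) (emb S) \<and>
     (\<forall>u\<in>L2_space (Xi S). \<forall>\<epsilon>>0. \<exists>h. L2_norm (Xi S) (\<lambda>\<xi>. u \<xi> - emb S h \<xi>) < \<epsilon>) \<and>
     (\<forall>v\<in>Pi {..<dims S} (spc S). AE \<xi> in Xi S. AE x in Omega S.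
        fnV S (emb S (tens S v) \<xi>) x =
          (\<Prod>m<dims S. fnH S m (v m) (merge {..<dimx S} {dimx S..<dims S} (x, \<xi>) m))) \<and>
     (\<forall>\<beta><rankA S. \<forall>m<dims S. bounded_operator (spc S m) (ivl S m) (facA S \<beta> m)) \<and>
     (\<exists>T. (\<forall>\<beta><rankA S. operator_tensor_product (dims S) (spc S) (tens S) (ivl S) (facA S \<beta>) (T \<beta>)) \<and>
        (\<forall>h. AE z in Dom S. opA S (emb S h) z = (\<Sum>\<beta><rankA S. T \<beta> h z)))"

definition separable_architecture ::
  "('v, 'h::{real_inner,complete_space}, 't) separable_problem \<Rightarrow> bool" where
  "separable_architecture S \<longleftrightarrow>
     (\<forall>m<dims S. \<forall>a<ncomp S m. \<forall>\<eta>\<in>euclid (npar S m).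
        wfun S m a \<eta> \<in> spc S m \<and> frechet_differentiable (npar S m) (wfun S m a) \<eta>)"

definition collocation_grid :: "('v, 'h, 't) separable_problem \<Rightarrow> bool" where
  "collocation_grid S \<longleftrightarrow> (\<forall>m<dims S. \<forall>i<npnt S m. pnt S m i \<in> {lo S m<..<hi S m})"

definition params :: "('v, 'h, 't) separable_problem \<Rightarrow> (nat \<Rightarrow> nat \<Rightarrow> real) set" where
  "params S = (\<Pi>\<^sub>E m\<in>{..<dims S}. euclid (npar S m))"

definition continuous_representatives ::
  "('v, 'h::{real_inner,complete_space}, 't) separable_problem \<Rightarrow> (nat \<Rightarrow> nat \<Rightarrow> real) \<Rightarrow> bool" where
  "continuous_representatives S \<theta> \<longleftrightarrow>
     (\<forall>\<beta><rankA S. \<forall>m<dims S. \<forall>a<ncomp S m.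
        (\<exists>g. is_cont_rep (ivl S m) {lo S m..hi S m} (facA S \<beta> m (wfun S m a (\<theta> m))) g) \<and>
        (\<forall>j<npar S m. \<exists>g. is_cont_rep (ivl S m) {lo S m..hi S m}
            (facA S \<beta> m (partial_deriv j (wfun S m a) (\<theta> m))) g))"

text \<open>The function \<open>u\<^sub>\<theta>\<close>, an element of the tensor product \<open>H\<close>, and its partial derivatives in \<open>H\<close>.\<close>

definition ufun ::
  "('v, 'h, 't::real_normed_vector) separable_problem \<Rightarrow> (nat \<Rightarrow> nat \<Rightarrow> real) \<Rightarrow> 't" where
  "ufun S \<theta> = (\<Sum>a\<in>multi_indices {..<dims S} (ncomp S).
      coef S a *\<^sub>R tens S (\<lambda>m. wfun S m (a m) (\<theta> m)))"

definition ufun_deriv ::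
  "('v, 'h, 't::real_normed_vector) separable_problem \<Rightarrow> (nat \<Rightarrow> nat \<Rightarrow> real) \<Rightarrow> nat \<Rightarrow> nat \<Rightarrow> 't" where
  "ufun_deriv S \<theta> s j = partial_deriv j (\<lambda>\<eta>. ufun S (\<theta>(s := \<eta>))) (\<theta> s)"

definition grid_point :: "('v, 'h, 't) separable_problem \<Rightarrow> (nat \<Rightarrow> nat) \<Rightarrow> (nat \<Rightarrow> real)" where
  "grid_point S i = (\<lambda>m\<in>{..<dims S}. pnt S m (i m))"

definition others :: "('v, 'h, 't) separable_problem \<Rightarrow> nat \<Rightarrow> nat set" where
  "others S s = {..<dims S} - {s}"

definition num_points :: "('v, 'h, 't) separable_problem \<Rightarrow> nat set \<Rightarrow> nat" where
  "num_points S I = (\<Prod>m\<in>I. npnt S m)"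

text \<open>The point value of \<open>\<A>\<^sub>m\<^sup>(\<^sup>\<beta>\<^sup>) v\<close> at the grid point \<open>z\<^sub>m\<^sub>,\<^sub>i\<close>.\<close>

definition fac_at ::
  "('v, 'h, 't) separable_problem \<Rightarrow> nat \<Rightarrow> nat \<Rightarrow> 'h \<Rightarrow> nat \<Rightarrow> real" where
  "fac_at S \<beta> m v i = point_value (ivl S m) {lo S m..hi S m} (facA S \<beta> m v) (pnt S m i)"

definition inactive_contraction ::
  "('v, 'h, 't) separable_problem \<Rightarrow> (nat \<Rightarrow> nat \<Rightarrow> real) \<Rightarrow> nat \<Rightarrow> nat \<Rightarrow> nat \<Rightarrow> (nat \<Rightarrow> nat) \<Rightarrow> real" where
  "inactive_contraction S \<theta> s \<beta> as i =
     (\<Sum>a\<in>multi_indices (others S s) (ncomp S).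
        coef S (a(s := as)) * (\<Prod>m\<in>others S s. fac_at S \<beta> m (wfun S m (a m) (\<theta> m)) (i m)))"

definition inactive_matrix ::
  "('v, 'h, 't) separable_problem \<Rightarrow> (nat \<Rightarrow> nat \<Rightarrow> real) \<Rightarrow> nat \<Rightarrow> nat \<Rightarrow> real mat" where
  "inactive_matrix S \<theta> s \<beta> = mat_of_cols (num_points S (others S s))
     (map (\<lambda>as. lex_vec (others S s) (npnt S) (inactive_contraction S \<theta> s \<beta> as)) [0..<ncomp S s])"

definition sensitivity_block ::
  "('v, 'h::real_normed_vector, 't) separable_problem \<Rightarrow> (nat \<Rightarrow> nat \<Rightarrow> real) \<Rightarrow> nat \<Rightarrow> nat \<Rightarrow> real mat"
where
  "sensitivity_block S \<theta> s \<beta> = mat (npnt S s * ncomp S s) (npar S s)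
     (\<lambda>(q, j). let i = q div ncomp S s; as = q mod ncomp S s
        in fac_at S \<beta> s (partial_deriv j (wfun S s as) (\<theta> s)) i)"

definition Psi_block ::
  "('v, 'h, 't) separable_problem \<Rightarrow> (nat \<Rightarrow> nat \<Rightarrow> real) \<Rightarrow> nat \<Rightarrow> nat \<Rightarrow> real mat" where
  "Psi_block S \<theta> s \<beta> = mat (num_points S {..<dims S}) (npnt S s * ncomp S s)
     (\<lambda>(p, q). let i = lex_index {..<dims S} (npnt S) p;
                   js = q div ncomp S s; as = q mod ncomp S s
        in if i s = js
           then inactive_matrix S \<theta> s \<beta> $$ (lex_pos (others S s) (npnt S) (restrict i (others S s)), as)
           else 0)"

text \<open>The blocks of the concatenated matrices all have size \<open>npnt s * ncomp s\<close> in the direction of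
  concatenation.\<close>

definition Psi_matrix ::
  "('v, 'h, 't) separable_problem \<Rightarrow> (nat \<Rightarrow> nat \<Rightarrow> real) \<Rightarrow> nat \<Rightarrow> real mat" where
  "Psi_matrix S \<theta> s = (let b = npnt S s * ncomp S s in
     mat (num_points S {..<dims S}) (rankA S * b)
       (\<lambda>(p, q). Psi_block S \<theta> s (q div b) $$ (p, q mod b)))"

definition sensitivity_matrix ::
  "('v, 'h::real_normed_vector, 't) separable_problem \<Rightarrow> (nat \<Rightarrow> nat \<Rightarrow> real) \<Rightarrow> nat \<Rightarrow> real mat" where
  "sensitivity_matrix S \<theta> s = (let b = npnt S s * ncomp S s in
     mat (rankA S * b) (npar S s)
       (\<lambda>(q, j). sensitivity_block S \<theta> s (q div b) $$ (q mod b, j)))"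

definition jacobian_block ::
  "('v, 'h, 't::real_normed_vector) separable_problem \<Rightarrow> (nat \<Rightarrow> nat \<Rightarrow> real) \<Rightarrow> nat \<Rightarrow> real mat" where
  "jacobian_block S \<theta> s = mat (num_points S {..<dims S}) (npar S s)
     (\<lambda>(p, j). point_value (Dom S) (closed_box S {..<dims S}) (opA S (emb S (ufun_deriv S \<theta> s j)))
        (grid_point S (lex_index {..<dims S} (npnt S) p)))"

end

theory Submission
  imports Defs
begin

text \<open>
  An elementary tensor depends linearly and boundedly on its \<open>s\<close>-th slot, so \<open>\<partial>u\<^sub>\<theta>\<close> in \<open>H\<close> is the
  sum defining \<open>u\<^sub>\<theta>\<close> with the \<open>s\<close>-th factor replaced by its partial derivative; the derivative stays
  in \<open>H\<^sub>s\<close> because \<open>H\<^sub>s\<close> is closed. Hence \<open>\<A>\<partial>u\<^sub>\<theta>\<close> is almost everywhere a finite sum of products of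
  the one-dimensional functions \<open>\<A>\<^sub>m\<^sup>(\<^sup>\<beta>\<^sup>) w\<^sub>m\<close> and \<open>\<A>\<^sub>s\<^sup>(\<^sup>\<beta>\<^sup>) \<partial>w\<^sub>s\<close>. Replacing these by their
  continuous representatives gives a continuous representative on the closed box. Two such
  representatives agree on the open box, since nonempty open sets have positive measure; so point
  values can be computed factor by factor. The matrix identity then amounts to splitting off the
  index \<open>a\<^sub>s\<close> in the sum over all \<open>a\<close>.
\<close>

subsection \<open>Lexicographic positions\<close>

lemma lex_pos_cong: "(\<And>m. m \<in> I \<Longrightarrow> i m = i' m) \<Longrightarrow> lex_pos I n i = lex_pos I n i'"
  unfolding lex_pos_def by (rule sum.cong) auto

text \<open>Mixed-radix recursion: the smallest direction is the slowest digit, so its weight is the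
  product over all of \<open>A\<close>. It is the step of the inductions below, which insert a new
  minimum each time.\<close>

lemma lex_pos_insert:
  assumes "finite A" "\<forall>a\<in>A. b < a"
  shows "lex_pos (insert b A) n i = i b * (\<Prod>l\<in>A. n l) + lex_pos A n i"
proof -
  have "b \<notin> A" using assms by auto
  moreover have "{l \<in> insert b A. b < l} = A" using assms by auto
  moreover have "{l \<in> insert b A. m < l} = {l \<in> A. m < l}" if "m \<in> A" for m
    using assms that by auto
  ultimately show ?thesis using assms(1) unfolding lex_pos_def by simp
qed

lemma lex_pos_less:
  assumes "finite I" "i \<in> multi_indices I n"
  shows "lex_pos I n i < (\<Prod>m\<in>I. n m)"
  using assms
proof (induction I arbitrary: i rule: finite_linorder_min_induct)
  case empty
  then show ?case by (simp add: lex_pos_def)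
next
  case (insert b A)
  let ?Q = "\<Prod>l\<in>A. n l"
  have "restrict i A \<in> multi_indices A n"
    using insert.prems by (auto simp: multi_indices_def)
  then have "lex_pos A n (restrict i A) < ?Q" by (rule insert.IH)
  then have "lex_pos A n i < ?Q"
    using lex_pos_cong[of A "restrict i A" i n] by simp
  moreover have "i b < n b" using insert.prems by (auto simp: multi_indices_def)
  \<comment> \<open>Since the lower digits contribute less than \<open>?Q\<close>, the position is
    below \<open>Suc (i b) * ?Q\<close>, which this line bounds by the full product.\<close>
  then have "Suc (i b) * ?Q \<le> n b * ?Q" by (intro mult_right_mono) auto
  moreover have "b \<notin> A" using insert.hyps by auto
  ultimately show ?case using insert.hyps by (simp add: lex_pos_insert)
qed

lemma inj_on_lex_pos:
  assumes "finite I"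
  shows "inj_on (lex_pos I n) (multi_indices I n)"
  using assms
proof (induction I rule: finite_linorder_min_induct)
  case empty
  then show ?case by (simp add: multi_indices_def)
next
  case (insert b A)
  let ?Q = "\<Prod>l\<in>A. n l"
  show ?case
  proof (rule inj_onI)
    fix x y
    assume x: "x \<in> multi_indices (insert b A) n" and y: "y \<in> multi_indices (insert b A) n"
      and eq: "lex_pos (insert b A) n x = lex_pos (insert b A) n y"
    have r: "restrict x A \<in> multi_indices A n" "restrict y A \<in> multi_indices A n"
      using x y by (auto simp: multi_indices_def)
    have c: "lex_pos A n x = lex_pos A n (restrict x A)" "lex_pos A n y = lex_pos A n (restrict y A)"
      by (rule lex_pos_cong; simp)+
    have lt: "lex_pos A n x < ?Q" "lex_pos A n y < ?Q"
      using lex_pos_less[OF insert.hyps(1)] r c by metis+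
    have e: "x b * ?Q + lex_pos A n x = y b * ?Q + lex_pos A n y"
      using eq insert.hyps by (simp add: lex_pos_insert)
    \<comment> \<open>\<open>lt\<close> makes \<open>?Q\<close> positive and the lower digits a
      genuine remainder, so division by \<open>?Q\<close> recovers the leading digit.\<close>
    have "x b = (x b * ?Q + lex_pos A n x) div ?Q" using lt by simp
    also have "\<dots> = y b" unfolding e using lt by simp
    finally have b: "x b = y b" .
    with e c have "lex_pos A n (restrict x A) = lex_pos A n (restrict y A)" by simp
    then have "restrict x A = restrict y A" using insert.IH r by (auto dest: inj_onD)
    then have "x a = y a" if "a \<in> insert b A" for a using that b by (metis insertE restrict_apply')
    then show "x = y" using x y unfolding multi_indices_def by (metis PiE_ext)
  qed
qed

text \<open>Surjectivity comes from counting: an injective map into a finite set of the same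
  cardinality is onto.\<close>

lemma bij_betw_lex_pos:
  assumes "finite I"
  shows "bij_betw (lex_pos I n) (multi_indices I n) {..<\<Prod>m\<in>I. n m}"
proof -
  have "lex_pos I n ` multi_indices I n \<subseteq> {..<\<Prod>m\<in>I. n m}"
    using lex_pos_less[OF assms] by auto
  moreover have "card (lex_pos I n ` multi_indices I n) = card {..<\<Prod>m\<in>I. n m}"
    using card_image[OF inj_on_lex_pos[OF assms], of n] card_PiE[OF assms, of "\<lambda>m. {..<n m}"]
    by (simp add: multi_indices_def)
  ultimately show ?thesis
    using inj_on_lex_pos[OF assms] by (simp add: bij_betw_def card_subset_eq)
qed

lemma lex_index_lex_pos:
  assumes "finite I" "i \<in> multi_indices I n"
  shows "lex_index I n (lex_pos I n i) = i"
  unfolding lex_index_def by (rule the_inv_into_f_f[OF inj_on_lex_pos[OF assms(1)] assms(2)])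

lemma lex_index_in:
  assumes "finite I" "p < (\<Prod>m\<in>I. n m)"
  shows "lex_index I n p \<in> multi_indices I n"
  using bij_betw_lex_pos[OF assms(1), of n] assms(2) unfolding lex_index_def bij_betw_def
  by (auto intro: the_inv_into_into)

section \<open>Reindexing sums over multi-indices and flattened pairs\<close>

lemma sum_multi_indices_insert:
  assumes "finite I" "s \<notin> I"
  shows "(\<Sum>a\<in>multi_indices (insert s I) n. f a) =
    (\<Sum>b<n s. \<Sum>a\<in>multi_indices I n. f (a(s := b)))"
proof -
  have "inj_on (\<lambda>(b, a). a(s := b)) ({..<n s} \<times> multi_indices I n)"
    unfolding multi_indices_def using assms by (intro inj_combinator)
  then show ?thesis
    unfolding multi_indices_def PiE_insert_eq
    by (subst sum.reindex) (simp_all add: sum.cartesian_product case_prod_unfold)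
qed

text \<open>Undoes the flattening of a pair to \<open>i * k + a\<close>. It serves twice in the
  matrix product: for the blocks indexed by \<beta>, and for the pairs (grid index, component)
  inside a block.\<close>

lemma sum_div_mod:
  fixes f :: "nat \<Rightarrow> nat \<Rightarrow> 'a::comm_monoid_add"
  shows "(\<Sum>q<n * k. f (q div k) (q mod k)) = (\<Sum>i<n. \<Sum>a<k. f i a)"
proof -
  have "(\<Sum>a<k. f i a) = (\<Sum>q\<in>{i * k..<i * k + k}. f (q div k) (q mod k))" for i
    by (rule sum.reindex_bij_witness[of _ "\<lambda>q. q - i * k" "\<lambda>a. i * k + a"])
      (auto simp: div_nat_eqI mod_nat_eqI  algebra_simps)
  then show ?thesis by (simp add: sum.nat_group)
qed

subsection \<open>Point values on a box\<close>

lemma product_sigma_finite_ivl: "product_sigma_finite (ivl S)"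
  unfolding product_sigma_finite_def ivl_def
  by (auto intro: sigma_finite_measure_restrict_space sigma_finite_lborel)

text \<open>The exceptional set lies in a cylinder whose \<open>m\<close>-th side is a null set
  \<open>N\<close>; its measure is a product with a zero factor, hence zero even if other factors
  are infinite.\<close>

lemma AE_PiM_coordinate:
  assumes "product_sigma_finite M" "finite I" "m \<in> I" "AE x in M m. P x"
  shows "AE z in PiM I M. P (z m)"
proof -
  interpret product_sigma_finite M by fact
  obtain N where N: "{x \<in> space (M m). \<not> P x} \<subseteq> N" "emeasure (M m) N = 0" "N \<in> sets (M m)"
    using AE_E[OF assms(4)] .
  let ?A = "\<lambda>l. if l = m then N else space (M l)"
  have "emeasure (PiM I M) (Pi\<^sub>E I ?A) = (\<Prod>l\<in>I. emeasure (M l) (?A l))"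
    using N by (intro emeasure_PiM) (auto simp: assms)
  also have "\<dots> = 0" using assms(2,3) N(2) by (intro prod_zero) auto
  finally have "Pi\<^sub>E I ?A \<in> null_sets (PiM I M)"
    using assms(2) N(3) by (auto intro!: sets_PiM_I_finite)
  then show ?thesis
    by (rule AE_I') (use N(1) assms(3) in \<open>auto simp: space_PiM PiE_iff extensional_def\<close>)
qed

lemma emeasure_ivl_pos:
  assumes "open X" "x \<in> X" "x \<in> {lo S m<..<hi S m}"
  shows "X \<inter> {lo S m<..<hi S m} \<in> sets (ivl S m)"
    and "emeasure (ivl S m) (X \<inter> {lo S m<..<hi S m}) \<noteq> 0"
proof -
  let ?Y = "X \<inter> {lo S m<..<hi S m}"
  have o: "open ?Y" using assms by auto
  then show "?Y \<in> sets (ivl S m)"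
    unfolding ivl_def by (subst sets_restrict_space_iff) auto
  obtain e where "e > 0" "ball x e \<subseteq> ?Y" using o assms openE by blast
  then have "emeasure lborel (ball x e) \<le> emeasure lborel ?Y"
    using o by (intro emeasure_mono) auto
  moreover have "emeasure lborel (ball x e) > 0"
    using \<open>e > 0\<close> by (simp add: ball_eq_greaterThanLessThan)
  ultimately show "emeasure (ivl S m) ?Y \<noteq> 0"
    unfolding ivl_def by (subst emeasure_restrict_space) auto
qed

text \<open>If \<open>g\<close> and \<open>g'\<close> differed at \<open>z\<close>, continuity would
  make them differ on a small product box around \<open>z\<close>; that box has positive measure,
  although the two functions agree almost everywhere.\<close>

lemma cont_reps_eq:
  assumes f: "is_cont_rep (Dom S) (closed_box S {..<dims S}) f g"
    and f': "is_cont_rep (Dom S) (closed_box S {..<dims S}) f g'"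
    and z: "z \<in> (\<Pi>\<^sub>E m\<in>{..<dims S}. {lo S m<..<hi S m})"
  shows "g z = g' z"
proof (rule ccontr)
  assume ne: "g z \<noteq> g' z"
  let ?K = "closed_box S {..<dims S}"
  let ?O = "\<lambda>m. {lo S m<..<hi S m}"
  interpret product_sigma_finite "ivl S" by (rule product_sigma_finite_ivl)
  have "continuous_on ?K (\<lambda>z. g z - g' z)"
    using f f' by (auto simp: is_cont_rep_def intro: continuous_intros)
  then obtain U where U: "open U" "U \<inter> ?K = (\<lambda>z. g z - g' z) -` (- {0}) \<inter> ?K"
    using continuous_on_open_invariant[of ?K "\<lambda>z. g z - g' z"] by (meson open_Compl closed_singleton)
  have "z \<in> ?K" using z unfolding closed_box_def by (auto simp: PiE_iff less_imp_le)
  then have "z \<in> U" using U ne by auto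
  \<comment> \<open>The topology is the product topology on all functions from \<open>nat\<close>,
    so the basic neighbourhood constrains coordinates beyond \<open>dims S\<close> as well.\<close>
  then obtain X where X: "z \<in> Pi\<^sub>E UNIV X" "\<And>m. open (X m)" "Pi\<^sub>E UNIV X \<subseteq> U"
    using product_topology_open_contains_basis[of "\<lambda>_. euclidean" UNIV U z] U(1)
    by (auto simp: open_fun_def)
  let ?B = "\<Pi>\<^sub>E m\<in>{..<dims S}. X m \<inter> ?O m"
  have B: "?B \<subseteq> Pi\<^sub>E UNIV X \<inter> (\<Pi>\<^sub>E m\<in>{..<dims S}. ?O m)"
  proof
    fix y assume y: "y \<in> ?B"
    \<comment> \<open>For \<open>m \<ge> dims S\<close> both \<open>y\<close> and \<open>z\<close>
      are \<open>undefined\<close> by extensionality, so \<open>y m\<close> inherits membership in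
      \<open>X m\<close> from \<open>z m\<close>.\<close>
    then have "y m \<in> X m" for m
      using X(1) z by (cases "m < dims S") (auto simp: PiE_iff extensional_def dest: spec[of _ m])
    then show "y \<in> Pi\<^sub>E UNIV X \<inter> (\<Pi>\<^sub>E m\<in>{..<dims S}. ?O m)" using y by (auto simp: PiE_iff)
  qed
  have pos: "X m \<inter> ?O m \<in> sets (ivl S m)" "emeasure (ivl S m) (X m \<inter> ?O m) \<noteq> 0" if "m < dims S" for m
    using emeasure_ivl_pos[OF X(2), of "z m" m S m] X(1) z that by (auto simp: PiE_iff)
  have "emeasure (Dom S) ?B = (\<Prod>m<dims S. emeasure (ivl S m) (X m \<inter> ?O m))"
    unfolding Dom_def box_measure_def using pos by (intro emeasure_PiM) auto
  then have B0: "emeasure (Dom S) ?B \<noteq> 0" using pos by simp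
  have "AE y in Dom S. g y = g' y" using f f' unfolding is_cont_rep_def by auto
  then obtain N where N: "{y \<in> space (Dom S). g y \<noteq> g' y} \<subseteq> N" "emeasure (Dom S) N = 0" "N \<in> sets (Dom S)"
    using AE_E by blast
  have "?B \<subseteq> N"
  proof
    fix y assume y: "y \<in> ?B"
    have "y \<in> space (Dom S)"
      using y unfolding Dom_def box_measure_def space_PiM ivl_def by (auto simp: PiE_iff)
    moreover have "y \<in> U \<inter> ?K"
      using y subsetD[OF B y] X(3) unfolding closed_box_def by (auto simp: PiE_iff less_imp_le)
    then have "g y \<noteq> g' y" using U(2) by auto
    ultimately show "y \<in> N" using N(1) by auto
  qed
  then show False using emeasure_mono[of ?B N "Dom S"] N B0 by auto
qed

text \<open>The choice in \<open>point_value\<close> does not depend on the evaluation point, so all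
  values of one function come from a single representative.\<close>

lemma is_cont_rep_point_value:
  assumes "is_cont_rep M K f g"
  shows "is_cont_rep M K f (point_value M K f)"
  using someI[of "is_cont_rep M K f", OF assms] unfolding point_value_def by simp

text \<open>At interior points any explicit continuous representative may replace the chosen
  one.\<close>

lemma point_value_Dom:
  assumes "is_cont_rep (Dom S) (closed_box S {..<dims S}) f g"
    and "z \<in> (\<Pi>\<^sub>E m\<in>{..<dims S}. {lo S m<..<hi S m})"
  shows "point_value (Dom S) (closed_box S {..<dims S}) f z = g z"
  using cont_reps_eq[OF is_cont_rep_point_value[OF assms(1)] assms] .

lemma AE_Dom_coordinate:
  assumes "m < dims S" "AE x in ivl S m. P x"
  shows "AE z in Dom S. P (z m)"
  unfolding Dom_def box_measure_def
  by (rule AE_PiM_coordinate[OF product_sigma_finite_ivl _ _ assms(2)]) (simp_all add: assms(1))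

lemma is_cont_rep_prod:
  assumes "\<And>m. m < dims S \<Longrightarrow> is_cont_rep (ivl S m) {lo S m..hi S m} (f m) (g m)"
  shows "is_cont_rep (Dom S) (closed_box S {..<dims S}) (\<lambda>z. \<Prod>m<dims S. f m (z m))
    (\<lambda>z. \<Prod>m<dims S. g m (z m))"
proof -
  let ?K = "closed_box S {..<dims S}"
  have "continuous_on ?K (\<lambda>z. g m (z m))" if "m < dims S" for m
  proof (rule continuous_on_compose2[of "{lo S m..hi S m}" "g m"])
    show "continuous_on {lo S m..hi S m} (g m)" using assms[OF that] by (simp add: is_cont_rep_def)
    show "continuous_on ?K (\<lambda>z. z m)"
      by (rule continuous_on_subset[OF continuous_on_product_coordinates]) simp
    show "(\<lambda>z. z m) ` ?K \<subseteq> {lo S m..hi S m}" using that by (auto simp: closed_box_def PiE_iff)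
  qed
  moreover have "AE z in Dom S. \<forall>m\<in>{..<dims S}. f m (z m) = g m (z m)"
  proof (rule AE_finite_allI)
    fix m assume "m \<in> {..<dims S}"
    then show "AE z in Dom S. f m (z m) = g m (z m)"
      using assms[of m] AE_Dom_coordinate[of m S "\<lambda>x. f m x = g m x"] by (simp add: is_cont_rep_def)
  qed simp
  then have "AE z in Dom S. (\<Prod>m<dims S. f m (z m)) = (\<Prod>m<dims S. g m (z m))"
    by eventually_elim (auto intro!: prod.cong)
  ultimately show ?thesis unfolding is_cont_rep_def by (auto intro!: continuous_intros)
qed

lemma is_cont_rep_sum:
  assumes "finite A" "\<And>a. a \<in> A \<Longrightarrow> is_cont_rep M K (f a) (g a)"
  shows "is_cont_rep M K (\<lambda>z. \<Sum>a\<in>A. c a * f a z) (\<lambda>z. \<Sum>a\<in>A. c a * g a z)"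
proof -
  have "AE z in M. \<forall>a\<in>A. f a z = g a z"
    using assms by (intro AE_finite_allI) (auto simp: is_cont_rep_def)
  then have "AE z in M. (\<Sum>a\<in>A. c a * f a z) = (\<Sum>a\<in>A. c a * g a z)"
    by eventually_elim simp
  then show ?thesis using assms unfolding is_cont_rep_def by (auto intro!: continuous_intros)
qed

lemma is_cont_rep_cong_AE:
  assumes "is_cont_rep M K f' g" "AE t in M. f t = f' t"
  shows "is_cont_rep M K f g"
  using assms unfolding is_cont_rep_def by (auto elim: eventually_elim2)

subsection \<open>Differentiation\<close>

text \<open>Along the line \<open>x(j := t)\<close> the increment has one nonzero entry: its
  Euclidean norm is \<open>\<bar>t - x j\<bar>\<close> and the linear part is
  \<open>(t - x j) *\<^sub>R g j\<close>. Uniqueness of derivatives identifies \<open>g j\<close>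
  with \<open>partial_deriv\<close>.\<close>

lemma frechet_partial_deriv:
  assumes f: "frechet_differentiable P f x" and x: "x \<in> euclid P" and j: "j < P"
  shows "((\<lambda>t. f (x(j := t))) has_vector_derivative partial_deriv j f x) (at (x j))"
proof -
  obtain g where g: "\<And>\<epsilon>. \<epsilon> > 0 \<Longrightarrow> \<exists>\<delta>>0. \<forall>y\<in>euclid P. L2_set (\<lambda>j. y j - x j) {..<P} < \<delta> \<longrightarrow>
      norm (f y - f x - (\<Sum>j<P. (y j - x j) *\<^sub>R g j)) \<le> \<epsilon> * L2_set (\<lambda>j. y j - x j) {..<P}"
    using f unfolding frechet_differentiable_def by blast
  have L2: "L2_set (\<lambda>l. (x(j := t)) l - x l) {..<P} = \<bar>t - x j\<bar>" for t
  proof -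
    have "(\<Sum>l<P. ((x(j := t)) l - x l)\<^sup>2) = (\<Sum>l<P. if l = j then (t - x j)\<^sup>2 else 0)"
      by (rule sum.cong) auto
    then show ?thesis using j by (simp add: L2_set_def)
  qed
  have lin: "(\<Sum>l<P. ((x(j := t)) l - x l) *\<^sub>R g l) = (t - x j) *\<^sub>R g j" for t
  proof -
    have "(\<Sum>l<P. ((x(j := t)) l - x l) *\<^sub>R g l) = (\<Sum>l<P. if l = j then (t - x j) *\<^sub>R g j else 0)"
      by (rule sum.cong) auto
    then show ?thesis using j by simp
  qed
  have "x(j := t) \<in> euclid P" for t using x j by (auto simp: euclid_def PiE_iff extensional_def)
  then have "\<exists>\<delta>>0. \<forall>t. \<bar>t - x j\<bar> < \<delta> \<longrightarrow>
      norm (f (x(j := t)) - f x - (t - x j) *\<^sub>R g j) \<le> \<epsilon> * \<bar>t - x j\<bar>" if "\<epsilon> > 0" for \<epsilon>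
    using g[OF that] unfolding L2[symmetric] lin[symmetric] by blast
  then have "((\<lambda>t. f (x(j := t))) has_vector_derivative g j) (at (x j))"
    unfolding has_vector_derivative_def has_derivative_at_alt
    by (auto intro: bounded_linear_scaleR_left)
  then show ?thesis
    unfolding partial_deriv_def by (simp add: vector_derivative_at)
qed

text \<open>Difference quotients stay in the subspace, and \<open>D\<close> is their limit.\<close>

lemma vector_derivative_in_closed_subspace:
  assumes "(f has_vector_derivative D) (at x)" "closed X" "subspace X" "\<And>t. f t \<in> X"
  shows "D \<in> X"
proof -
  have "\<exists>y\<in>X. dist y D < e" if "e > 0" for e
  proof -
    \<comment> \<open>Half of \<open>e\<close> leaves room for the strict inequality;
      \<open>h = d / 2\<close> is then one admissible nonzero increment.\<close>
    have "e / 2 > 0" using that by simp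
    then obtain d where d: "d > 0"
      "\<And>y. norm (y - x) < d \<Longrightarrow> norm (f y - f x - (y - x) *\<^sub>R D) \<le> e / 2 * norm (y - x)"
      using assms(1) unfolding has_vector_derivative_def has_derivative_at_alt by blast
    define h where "h = d / 2"
    have h: "0 < h" "h < d" using d(1) by (auto simp: h_def)
    have "f (x + h) - f x - h *\<^sub>R D = h *\<^sub>R ((f (x + h) - f x) /\<^sub>R h - D)"
      using h by (simp add: scaleR_diff_right)
    then have "h * norm ((f (x + h) - f x) /\<^sub>R h - D) \<le> e / 2 * h"
      using d(2)[of "x + h"] h by simp
    then have "norm ((f (x + h) - f x) /\<^sub>R h - D) \<le> e / 2" using h by simp
    moreover have "(f (x + h) - f x) /\<^sub>R h \<in> X"
      using assms by (intro subspace_scale subspace_diff) auto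
    ultimately show ?thesis using that by (intro bexI) (auto simp: dist_norm)
  qed
  then have "D \<in> closure X" by (simp add: closure_approachable)
  then show ?thesis using assms(2) by simp
qed

text \<open>A slot of the elementary tensor is linear only on the subspace \<open>X\<close>, so the chain rule for
  bounded linear maps does not apply directly.\<close>

lemma has_vector_derivative_linear_on:
  assumes f: "(f has_vector_derivative D) (at x)"
    and X: "subspace X" "\<And>t. f t \<in> X" "D \<in> X"
    and add: "\<And>y z. y \<in> X \<Longrightarrow> z \<in> X \<Longrightarrow> L (y + z) = L y + L z"
    and scale: "\<And>r y. y \<in> X \<Longrightarrow> L (r *\<^sub>R y) = r *\<^sub>R L y"
    and bound: "\<And>y. y \<in> X \<Longrightarrow> norm (L y) \<le> K * norm y"
  shows "((\<lambda>t. L (f t)) has_vector_derivative L D) (at x)"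
  unfolding has_vector_derivative_def has_derivative_at_alt
proof (intro conjI allI impI)
  show "bounded_linear (\<lambda>t. t *\<^sub>R L D)" by (rule bounded_linear_scaleR_left)
  fix e :: real assume "e > 0"
  \<comment> \<open>The sign of \<open>K\<close> is unknown and it may vanish;
    \<open>\<bar>K\<bar> + 1\<close> is a positive upper bound.\<close>
  then have "e / (\<bar>K\<bar> + 1) > 0" by simp
  then obtain d where d: "d > 0"
    "\<And>y. norm (y - x) < d \<Longrightarrow> norm (f y - f x - (y - x) *\<^sub>R D) \<le> e / (\<bar>K\<bar> + 1) * norm (y - x)"
    using f unfolding has_vector_derivative_def has_derivative_at_alt by blast
  have diff: "L (y - z) = L y - L z" if "y \<in> X" "z \<in> X" for y z
    using add[of y "(-1) *\<^sub>R z"] scale[of z "-1"] that X(1) by (simp add: subspace_neg)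
  have "norm (L (f y) - L (f x) - (y - x) *\<^sub>R L D) \<le> e * norm (y - x)" if "norm (y - x) < d" for y
  proof -
    have "L (f y) - L (f x) - (y - x) *\<^sub>R L D = L (f y - f x - (y - x) *\<^sub>R D)"
      using X by (simp add: diff scale subspace_diff subspace_scale)
    also have "norm \<dots> \<le> K * norm (f y - f x - (y - x) *\<^sub>R D)"
      using X by (intro bound) (simp add: subspace_diff subspace_scale)
    also have "\<dots> \<le> (\<bar>K\<bar> + 1) * (e / (\<bar>K\<bar> + 1) * norm (y - x))"
      using d(2)[OF that] by (intro mult_mono) auto
    also have "\<dots> = e * norm (y - x)" by simp
    finally show ?thesis .
  qed
  then show "\<exists>d>0. \<forall>y. norm (y - x) < d \<longrightarrow> norm (L (f y) - L (f x) - (y - x) *\<^sub>R L D) \<le> e * norm (y - x)"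
    using d(1) by blast
qed

section \<open>Elementary tensors and the derivative of the architecture\<close>

lemma
  assumes "hilbert_tensor_product d Hs tp" "v \<in> Pi {..<d} Hs" "m < d"
  shows tens_add: "x \<in> Hs m \<Longrightarrow> y \<in> Hs m \<Longrightarrow>
      tp (v(m := x + y)) = tp (v(m := x)) + tp (v(m := y))"
    and tens_scale: "x \<in> Hs m \<Longrightarrow> tp (v(m := r *\<^sub>R x)) = r *\<^sub>R tp (v(m := x))"
  using assms unfolding hilbert_tensor_product_def by blast+

lemma norm_tens:
  assumes "hilbert_tensor_product d Hs tp" "v \<in> Pi {..<d} Hs"
  shows "norm (tp v) = (\<Prod>m<d. norm (v m))"
proof -
  have "inner (tp v) (tp v) = (\<Prod>m<d. inner (v m) (v m))"
    using assms unfolding hilbert_tensor_product_def by blast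
  then have "(norm (tp v))\<^sup>2 = (\<Prod>m<d. norm (v m))\<^sup>2"
    by (simp add: power2_norm_eq_inner prod_power_distrib)
  then show ?thesis by (simp add: prod_nonneg)
qed

text \<open>Supplies the bound for the slot map \<open>y \<mapsto> tp (v(s := y))\<close>: the
  product of the other norms is the constant \<open>K\<close> of
  \<open>has_vector_derivative_linear_on\<close>.\<close>

lemma norm_tens_upd:
  assumes "hilbert_tensor_product d Hs tp" "v \<in> Pi {..<d} Hs" "s < d" "y \<in> Hs s"
  shows "norm (tp (v(s := y))) = (\<Prod>m\<in>{..<d} - {s}. norm (v m)) * norm y"
proof -
  have "v(s := y) \<in> Pi {..<d} Hs" using assms by auto
  then have "norm (tp (v(s := y))) = (\<Prod>m<d. norm ((v(s := y)) m))"
    by (rule norm_tens[OF assms(1)])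
  also have "\<dots> = norm y * (\<Prod>m\<in>{..<d} - {s}. norm ((v(s := y)) m))"
    using assms(3) by (subst prod.remove[of _ s]) auto
  also have "(\<Prod>m\<in>{..<d} - {s}. norm ((v(s := y)) m)) = (\<Prod>m\<in>{..<d} - {s}. norm (v m))"
    by (rule prod.cong) auto
  finally show ?thesis by (simp only: mult.commute)
qed

lemma wfun_has_partial_deriv:
  assumes "separable_architecture S" "\<theta> \<in> params S" "s < dims S" "a < ncomp S s" "j < npar S s"
  shows "((\<lambda>t. wfun S s a ((\<theta> s)(j := t))) has_vector_derivative
      partial_deriv j (wfun S s a) (\<theta> s)) (at (\<theta> s j))"
    and "wfun S s a ((\<theta> s)(j := t)) \<in> spc S s"
proof -
  have \<theta>: "\<theta> s \<in> euclid (npar S s)" using assms by (auto simp: params_def)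
  then have "(\<theta> s)(j := t) \<in> euclid (npar S s)" for t
    using assms(5) by (auto simp: euclid_def PiE_iff extensional_def)
  then show "wfun S s a ((\<theta> s)(j := t)) \<in> spc S s"
    using assms unfolding separable_architecture_def by blast
  have "frechet_differentiable (npar S s) (wfun S s a) (\<theta> s)"
    using assms \<theta> unfolding separable_architecture_def by blast
  from frechet_partial_deriv[OF this \<theta> assms(5)]
  show "((\<lambda>t. wfun S s a ((\<theta> s)(j := t))) has_vector_derivative
      partial_deriv j (wfun S s a) (\<theta> s)) (at (\<theta> s j))" .
qed

text \<open>The factors of one term of the differentiated sum: the parameter block
  \<open>\<theta> s\<close> enters slot \<open>s\<close> only, so no other slot is
  differentiated.\<close>

definition deriv_factors ::
  "('v, 'h::real_normed_vector, 't) separable_problem \<Rightarrow> (nat \<Rightarrow> nat \<Rightarrow> real) \<Rightarrow> nat \<Rightarrow> nat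
     \<Rightarrow> (nat \<Rightarrow> nat) \<Rightarrow> nat \<Rightarrow> 'h" where
  "deriv_factors S \<theta> s j a =
     (\<lambda>m. wfun S m (a m) (\<theta> m))(s := partial_deriv j (wfun S s (a s)) (\<theta> s))"

context
  fixes S :: "('v::{real_inner,complete_space}, 'h::{real_inner,complete_space},
               't::{real_inner,complete_space}) separable_problem"
    and \<theta> :: "nat \<Rightarrow> nat \<Rightarrow> real" and s j :: nat
  assumes op: "separable_operator S" and arch: "separable_architecture S"
    and \<theta>: "\<theta> \<in> params S" and s: "s < dims S" and j: "j < npar S s"
begin

lemma deriv_factors_in:
  assumes "a \<in> multi_indices {..<dims S} (ncomp S)"
  shows "(\<lambda>m. wfun S m (a m) (\<theta> m)) \<in> Pi {..<dims S} (spc S)"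
    and "partial_deriv j (wfun S s (a s)) (\<theta> s) \<in> spc S s"
    and "deriv_factors S \<theta> s j a \<in> Pi {..<dims S} (spc S)"
proof -
  have a: "a m < ncomp S m" if "m < dims S" for m
    using assms that by (auto simp: multi_indices_def)
  have "\<theta> m \<in> euclid (npar S m)" if "m < dims S" for m
    using \<theta> that by (auto simp: params_def)
  with a show w: "(\<lambda>m. wfun S m (a m) (\<theta> m)) \<in> Pi {..<dims S} (spc S)"
    using arch unfolding separable_architecture_def by auto
  have "subspace (spc S s)" "closed (spc S s)" using op s unfolding separable_operator_def by auto
  with wfun_has_partial_deriv[OF arch \<theta> s a[OF s] j]
  show d: "partial_deriv j (wfun S s (a s)) (\<theta> s) \<in> spc S s"
    by (auto intro: vector_derivative_in_closed_subspace)
  show "deriv_factors S \<theta> s j a \<in> Pi {..<dims S} (spc S)"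
    using w d unfolding deriv_factors_def by auto
qed

text \<open>The coefficients are constant and each elementary tensor is linear and bounded in slot
  \<open>s\<close>, so the derivative passes through the sum and into that slot.\<close>

lemma ufun_deriv_eq:
  "ufun_deriv S \<theta> s j =
    (\<Sum>a\<in>multi_indices {..<dims S} (ncomp S). coef S a *\<^sub>R tens S (deriv_factors S \<theta> s j a))"
proof -
  have H: "hilbert_tensor_product (dims S) (spc S) (tens S)" and sub: "subspace (spc S s)"
    using op s unfolding separable_operator_def by auto
  have "((\<lambda>t. tens S (\<lambda>m. wfun S m (a m) ((\<theta>(s := (\<theta> s)(j := t))) m))) has_vector_derivative
      tens S (deriv_factors S \<theta> s j a)) (at (\<theta> s j))"
    if a: "a \<in> multi_indices {..<dims S} (ncomp S)" for a
  proof -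
    let ?v = "\<lambda>m. wfun S m (a m) (\<theta> m)"
    have as: "a s < ncomp S s" using a s by (auto simp: multi_indices_def)
    have "((\<lambda>t. tens S (?v(s := wfun S s (a s) ((\<theta> s)(j := t))))) has_vector_derivative
        tens S (?v(s := partial_deriv j (wfun S s (a s)) (\<theta> s)))) (at (\<theta> s j))"
      by (rule has_vector_derivative_linear_on[where X = "spc S s" and L = "\<lambda>y. tens S (?v(s := y))"
            and K = "\<Prod>m\<in>{..<dims S} - {s}. norm (?v m)"])
        (use wfun_has_partial_deriv[OF arch \<theta> s as j] deriv_factors_in[OF a] sub s
          in \<open>simp_all add: tens_add[OF H] tens_scale[OF H] norm_tens_upd[OF H]\<close>)
    moreover have "(\<lambda>m. wfun S m (a m) ((\<theta>(s := (\<theta> s)(j := t))) m)) =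
        ?v(s := wfun S s (a s) ((\<theta> s)(j := t)))" for t
      by auto
    ultimately show ?thesis unfolding deriv_factors_def by simp
  qed
  then have "((\<lambda>t. ufun S (\<theta>(s := (\<theta> s)(j := t)))) has_vector_derivative
      (\<Sum>a\<in>multi_indices {..<dims S} (ncomp S). coef S a *\<^sub>R tens S (deriv_factors S \<theta> s j a)))
      (at (\<theta> s j))"
    unfolding ufun_def
    by (intro has_vector_derivative_sum bounded_linear.has_vector_derivative[OF bounded_linear_scaleR_right])
  then show ?thesis
    unfolding ufun_deriv_def partial_deriv_def by (simp add: vector_derivative_at)
qed

end

section \<open>The operator applied to the differentiated architecture\<close>

text \<open>Linearity holds only almost everywhere; finitely many uses of it cost finitely many null
  sets.\<close>

lemma bounded_operator_sum:
  fixes T :: "'h::real_normed_vector \<Rightarrow> 'a \<Rightarrow> real"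
  assumes T: "bounded_operator UNIV M T" and "finite A"
  shows "AE z in M. T (\<Sum>a\<in>A. c a *\<^sub>R x a) z = (\<Sum>a\<in>A. c a * T (x a) z)"
  using \<open>finite A\<close>
proof induction
  case empty
  \<comment> \<open>Homogeneity with factor 0 yields \<open>T 0 = 0\<close> almost
    everywhere.\<close>
  have "AE z in M. T (0 *\<^sub>R 0) z = 0 *\<^sub>R T 0 z"
    using T unfolding bounded_linear_to_L2_def by blast
  then show ?case by simp
next
  case (insert a A)
  have "AE z in M. T (c a *\<^sub>R x a + (\<Sum>a\<in>A. c a *\<^sub>R x a)) z =
      T (c a *\<^sub>R x a) z + T (\<Sum>a\<in>A. c a *\<^sub>R x a) z"
    and "AE z in M. T (c a *\<^sub>R x a) z = c a *\<^sub>R T (x a) z"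
    using T unfolding bounded_linear_to_L2_def by blast+
  with insert.IH show ?case by eventually_elim (simp add: insert.hyps)
qed

text \<open>The operator splits into the tensor products \<open>T \<beta>\<close>, each of which
  turns an elementary tensor into a product of one-dimensional functions. Their continuous
  representatives then assemble to one on the closed box.\<close>

lemma is_cont_rep_opA_ufun_deriv:
  fixes S :: "('v::{real_inner,complete_space}, 'h::{real_inner,complete_space},
               't::{real_inner,complete_space}) separable_problem"
  assumes op: "separable_operator S" and arch: "separable_architecture S"
    and \<theta>: "\<theta> \<in> params S" and s: "s < dims S" and j: "j < npar S s"
    and rep: "continuous_representatives S \<theta>"
  shows "is_cont_rep (Dom S) (closed_box S {..<dims S}) (opA S (emb S (ufun_deriv S \<theta> s j)))
    (\<lambda>z. \<Sum>\<beta><rankA S. \<Sum>a\<in>multi_indices {..<dims S} (ncomp S). coef S a *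
      (\<Prod>m<dims S. point_value (ivl S m) {lo S m..hi S m} (facA S \<beta> m (deriv_factors S \<theta> s j a m)) (z m)))"
    (is "is_cont_rep ?M ?K ?f ?g")
proof (rule is_cont_rep_cong_AE)
  let ?A = "multi_indices {..<dims S} (ncomp S)"
  let ?v = "deriv_factors S \<theta> s j"
  have fin: "finite ?A" unfolding multi_indices_def by (intro finite_PiE) auto
  have "is_cont_rep ?M ?K (\<lambda>z. \<Prod>m<dims S. facA S \<beta> m (?v a m) (z m))
      (\<lambda>z. \<Prod>m<dims S. point_value (ivl S m) {lo S m..hi S m} (facA S \<beta> m (?v a m)) (z m))"
    if "\<beta> < rankA S" "a \<in> ?A" for \<beta> a
  proof (intro is_cont_rep_prod)
    fix m assume m: "m < dims S"
    then have "a m < ncomp S m" using that by (auto simp: multi_indices_def)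
    \<comment> \<open>The two clauses of \<open>continuous_representatives\<close> match the two
      cases of \<open>deriv_factors\<close>: the derivative clause for \<open>m = s\<close>, the
      plain one otherwise.\<close>
    then have "\<exists>g. is_cont_rep (ivl S m) {lo S m..hi S m} (facA S \<beta> m (?v a m)) g"
      using rep that(1) m j unfolding continuous_representatives_def deriv_factors_def by auto
    then show "is_cont_rep (ivl S m) {lo S m..hi S m} (facA S \<beta> m (?v a m))
        (point_value (ivl S m) {lo S m..hi S m} (facA S \<beta> m (?v a m)))"
      using is_cont_rep_point_value by blast
  qed
  \<comment> \<open>The factor 1 gives the outer sum the weighted shape of
    \<open>is_cont_rep_sum\<close>.\<close>
  then have "is_cont_rep ?M ?K (\<lambda>z. \<Sum>\<beta><rankA S. 1 * (\<Sum>a\<in>?A. coef S a *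
        (\<Prod>m<dims S. facA S \<beta> m (?v a m) (z m)))) (\<lambda>z. \<Sum>\<beta><rankA S. 1 * (\<Sum>a\<in>?A. coef S a *
        (\<Prod>m<dims S. point_value (ivl S m) {lo S m..hi S m} (facA S \<beta> m (?v a m)) (z m))))"
    using fin by (intro is_cont_rep_sum) auto
  then show "is_cont_rep ?M ?K (\<lambda>z. \<Sum>\<beta><rankA S. \<Sum>a\<in>?A. coef S a *
        (\<Prod>m<dims S. facA S \<beta> m (?v a m) (z m))) ?g"
    by simp
  obtain T where T: "\<forall>\<beta><rankA S. operator_tensor_product (dims S) (spc S) (tens S) (ivl S) (facA S \<beta>) (T \<beta>)"
    and sum: "\<forall>h. AE z in Dom S. opA S (emb S h) z = (\<Sum>\<beta><rankA S. T \<beta> h z)"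
    using op unfolding separable_operator_def by blast
  have "AE z in ?M. T \<beta> (ufun_deriv S \<theta> s j) z =
      (\<Sum>a\<in>?A. coef S a * (\<Prod>m<dims S. facA S \<beta> m (?v a m) (z m)))" if "\<beta> < rankA S" for \<beta>
  proof -
    have bd: "bounded_operator UNIV ?M (T \<beta>)"
      and el: "\<And>v. v \<in> Pi {..<dims S} (spc S) \<Longrightarrow>
        AE z in ?M. T \<beta> (tens S v) z = (\<Prod>m<dims S. facA S \<beta> m (v m) (z m))"
      using T that unfolding operator_tensor_product_def Dom_def box_measure_def by auto
    have "AE z in ?M. \<forall>a\<in>?A. T \<beta> (tens S (?v a)) z = (\<Prod>m<dims S. facA S \<beta> m (?v a m) (z m))"
      using el[OF deriv_factors_in(3)[OF op arch \<theta> s j]] by (rule AE_finite_allI[OF fin])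
    with bounded_operator_sum[OF bd fin, of "coef S" "\<lambda>a. tens S (?v a)"]
    show ?thesis
      unfolding ufun_deriv_eq[OF op arch \<theta> s j] by eventually_elim simp
  qed
  then have "AE z in ?M. \<forall>\<beta>\<in>{..<rankA S}. T \<beta> (ufun_deriv S \<theta> s j) z =
      (\<Sum>a\<in>?A. coef S a * (\<Prod>m<dims S. facA S \<beta> m (?v a m) (z m)))"
    by (intro AE_finite_allI) auto
  with sum[rule_format, of "ufun_deriv S \<theta> s j"]
  show "AE z in ?M. ?f z = (\<Sum>\<beta><rankA S. \<Sum>a\<in>?A. coef S a *
        (\<Prod>m<dims S. facA S \<beta> m (?v a m) (z m)))"
    by eventually_elim simp
qed

subsection \<open>The factorization\<close>

lemma finite_others [simp]: "finite (others S s)"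
  by (simp add: others_def)

lemma inactive_matrix_dim:
  "inactive_matrix S \<theta> s \<beta> \<in> carrier_mat (num_points S (others S s)) (ncomp S s)"
  unfolding inactive_matrix_def carrier_mat_def by simp

lemma inactive_matrix_index:
  assumes "i \<in> multi_indices (others S s) (npnt S)" "as < ncomp S s"
  shows "inactive_matrix S \<theta> s \<beta> $$ (lex_pos (others S s) (npnt S) i, as) =
    inactive_contraction S \<theta> s \<beta> as i"
proof -
  have "lex_pos (others S s) (npnt S) i < num_points S (others S s)"
    using lex_pos_less[OF _ assms(1)] by (simp add: num_points_def)
  then show ?thesis
    using assms unfolding inactive_matrix_def
    by (simp add: mat_of_cols_index lex_vec_def lex_index_lex_pos num_points_def)
qed

text \<open>\<open>Psi_block\<close> looks up the restricted grid index, while the formulas below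
  carry the full one.\<close>

lemma inactive_contraction_restrict:
  "inactive_contraction S \<theta> s \<beta> as (restrict i (others S s)) = inactive_contraction S \<theta> s \<beta> as i"
  unfolding inactive_contraction_def by (intro sum.cong prod.cong arg_cong2[of _ _ _ _ "(*)"] refl) simp

text \<open>The inner index of the product encodes a triple (term, grid index in direction
  \<open>s\<close>, component). After decoding, the Kronecker delta in \<open>Psi_block\<close>
  leaves only the grid index \<open>i s\<close>.\<close>

lemma Psi_sensitivity_index:
  assumes s: "s < dims S" and p: "p < num_points S {..<dims S}" and j: "j < npar S s"
  defines "i \<equiv> lex_index {..<dims S} (npnt S) p"
  shows "(Psi_matrix S \<theta> s * sensitivity_matrix S \<theta> s) $$ (p, j) =
    (\<Sum>\<beta><rankA S. \<Sum>as<ncomp S s. inactive_contraction S \<theta> s \<beta> as i *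
      fac_at S \<beta> s (partial_deriv j (wfun S s as) (\<theta> s)) (i s))"
proof -
  let ?k = "ncomp S s" and ?n = "npnt S s" and ?O = "others S s"
  let ?b = "?n * ?k"
  let ?D = "\<lambda>\<beta> as. fac_at S \<beta> s (partial_deriv j (wfun S s as) (\<theta> s))"
  have i: "i \<in> multi_indices {..<dims S} (npnt S)"
    unfolding i_def using p by (intro lex_index_in) (auto simp: num_points_def)
  then have i_s: "i s < ?n" and iO: "restrict i ?O \<in> multi_indices ?O (npnt S)"
    using s by (auto simp: multi_indices_def others_def)
  have block: "(\<Sum>q<?b. Psi_block S \<theta> s \<beta> $$ (p, q) * sensitivity_block S \<theta> s \<beta> $$ (q, j)) =
      (\<Sum>as<?k. inactive_contraction S \<theta> s \<beta> as i * ?D \<beta> as (i s))" for \<beta>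
  proof -
    \<comment> \<open>The summand is written as a function applied to quotient and remainder, the
      form that \<open>sum_div_mod\<close> expects.\<close>
    have "(\<Sum>q<?b. Psi_block S \<theta> s \<beta> $$ (p, q) * sensitivity_block S \<theta> s \<beta> $$ (q, j)) =
        (\<Sum>q<?b. (\<lambda>js as. (if i s = js then inactive_contraction S \<theta> s \<beta> as i else 0) *
          ?D \<beta> as js) (q div ?k) (q mod ?k))"
    proof (rule sum.cong[OF refl])
      fix q assume "q \<in> {..<?b}"
      then have q: "q < ?b" by simp
      \<comment> \<open>\<open>q < ?n * ?k\<close> forces \<open>?k\<close> to be positive, so the
        remainder is a valid component index.\<close>
      then have "q mod ?k < ?k" by (metis less_nat_zero_code mod_less_divisor mult_0_right not_gr_zero)
      then show "Psi_block S \<theta> s \<beta> $$ (p, q) * sensitivity_block S \<theta> s \<beta> $$ (q, j) =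
          (\<lambda>js as. (if i s = js then inactive_contraction S \<theta> s \<beta> as i else 0) *
          ?D \<beta> as js) (q div ?k) (q mod ?k)"
        using p j q inactive_matrix_index[OF iO, of "q mod ?k" \<theta> \<beta>]
        unfolding Psi_block_def sensitivity_block_def Let_def
        by (simp add: i_def[symmetric] inactive_contraction_restrict)
    qed
    also have "\<dots> = (\<Sum>js<?n. \<Sum>as<?k. (if i s = js then inactive_contraction S \<theta> s \<beta> as i else 0) *
          ?D \<beta> as js)"
      by (rule sum_div_mod)
    also have "\<dots> = (\<Sum>js<?n. if i s = js then
        \<Sum>as<?k. inactive_contraction S \<theta> s \<beta> as i * ?D \<beta> as js else 0)"
      by (rule sum.cong) auto
    also have "\<dots> = (\<Sum>as<?k. inactive_contraction S \<theta> s \<beta> as i * ?D \<beta> as (i s))"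
      \<comment> \<open>\<open>i s < ?n\<close> puts the surviving index inside the range of
        summation.\<close>
      using i_s by simp
    finally show ?thesis .
  qed
  have "(Psi_matrix S \<theta> s * sensitivity_matrix S \<theta> s) $$ (p, j) =
      (\<Sum>q<rankA S * ?b. Psi_matrix S \<theta> s $$ (p, q) * sensitivity_matrix S \<theta> s $$ (q, j))"
    using p j by (simp add: Psi_matrix_def sensitivity_matrix_def Let_def scalar_prod_def
        lessThan_atLeast0)
  also have "\<dots> = (\<Sum>q<rankA S * ?b. (\<lambda>\<beta> q. Psi_block S \<theta> s \<beta> $$ (p, q) *
      sensitivity_block S \<theta> s \<beta> $$ (q, j)) (q div ?b) (q mod ?b))"
    using p j by (intro sum.cong) (simp_all add: Psi_matrix_def sensitivity_matrix_def Let_def)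
  also have "\<dots> = (\<Sum>\<beta><rankA S. \<Sum>q<?b. Psi_block S \<theta> s \<beta> $$ (p, q) *
      sensitivity_block S \<theta> s \<beta> $$ (q, j))"
    by (rule sum_div_mod)
  finally show ?thesis by (simp add: block)
qed

text \<open>Writing each multi-index as \<open>a(s := as)\<close> separates the differentiated
  factor, constant in the other indices; the remaining sum is the inactive contraction.\<close>

lemma sum_deriv_factors:
  assumes s: "s < dims S"
  shows "(\<Sum>a\<in>multi_indices {..<dims S} (ncomp S). coef S a *
      (\<Prod>m<dims S. fac_at S \<beta> m (deriv_factors S \<theta> s j a m) (i m))) =
    (\<Sum>as<ncomp S s. inactive_contraction S \<theta> s \<beta> as i *
      fac_at S \<beta> s (partial_deriv j (wfun S s as) (\<theta> s)) (i s))"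
proof -
  let ?O = "others S s"
  have ins: "{..<dims S} = insert s ?O" "s \<notin> ?O" using s by (auto simp: others_def)
  have eq: "coef S (a(s := as)) *
      (\<Prod>m<dims S. fac_at S \<beta> m (deriv_factors S \<theta> s j (a(s := as)) m) (i m)) =
      coef S (a(s := as)) * (\<Prod>m\<in>?O. fac_at S \<beta> m (wfun S m (a m) (\<theta> m)) (i m)) *
      fac_at S \<beta> s (partial_deriv j (wfun S s as) (\<theta> s)) (i s)" for a as
  proof -
    have "(\<Prod>m\<in>?O. fac_at S \<beta> m (deriv_factors S \<theta> s j (a(s := as)) m) (i m)) =
        (\<Prod>m\<in>?O. fac_at S \<beta> m (wfun S m (a m) (\<theta> m)) (i m))"
      using ins(2) by (intro prod.cong) (auto simp: deriv_factors_def)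
    then show ?thesis unfolding ins(1) using ins(2) by (simp add: deriv_factors_def)
  qed
  show ?thesis
    unfolding inactive_contraction_def sum_distrib_right
    by (simp only: sum_multi_indices_insert[OF finite_others ins(2), folded ins(1)] eq)
qed

lemma jacobian_block_index:
  fixes S :: "('v::{real_inner,complete_space}, 'h::{real_inner,complete_space},
               't::{real_inner,complete_space}) separable_problem"
  assumes "separable_operator S" "separable_architecture S" "collocation_grid S" "\<theta> \<in> params S"
    "continuous_representatives S \<theta>" "s < dims S" "p < num_points S {..<dims S}" "j < npar S s"
  defines "i \<equiv> lex_index {..<dims S} (npnt S) p"
  shows "jacobian_block S \<theta> s $$ (p, j) = (\<Sum>\<beta><rankA S. \<Sum>a\<in>multi_indices {..<dims S} (ncomp S).
    coef S a * (\<Prod>m<dims S. fac_at S \<beta> m (deriv_factors S \<theta> s j a m) (i m)))"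
proof -
  have "i \<in> multi_indices {..<dims S} (npnt S)"
    unfolding i_def using assms(7) by (intro lex_index_in) (auto simp: num_points_def)
  \<comment> \<open>Grid points are interior, where the point value can be read off from the
    representative found above.\<close>
  then have "grid_point S i \<in> (\<Pi>\<^sub>E m\<in>{..<dims S}. {lo S m<..<hi S m})"
    using assms(3) by (auto simp: grid_point_def collocation_grid_def multi_indices_def PiE_iff)
  from point_value_Dom[OF is_cont_rep_opA_ufun_deriv[OF assms(1,2,4,6,8,5)] this]
  have "jacobian_block S \<theta> s $$ (p, j) = (\<Sum>\<beta><rankA S. \<Sum>a\<in>multi_indices {..<dims S} (ncomp S).
      coef S a * (\<Prod>m<dims S. point_value (ivl S m) {lo S m..hi S m}
        (facA S \<beta> m (deriv_factors S \<theta> s j a m)) (grid_point S i m)))"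
    using assms(7,8) by (simp add: jacobian_block_def i_def)
  then show ?thesis by (simp add: fac_at_def grid_point_def)
qed

theorem lemma2p8:
  fixes S :: "('v::{real_inner,complete_space}, 'h::{real_inner,complete_space},
               't::{real_inner,complete_space}) separable_problem"
    and \<theta> :: "nat \<Rightarrow> nat \<Rightarrow> real"
  assumes "separable_domain S"
    and "separable_operator S"
    and "separable_architecture S"
    and "collocation_grid S"
    and "\<theta> \<in> params S"
    and "continuous_representatives S \<theta>"
  shows "\<forall>s<dims S.
     (\<forall>\<beta><rankA S.
        inactive_matrix S \<theta> s \<beta> \<in> carrier_mat (num_points S (others S s)) (ncomp S s) \<and>
        (\<forall>i\<in>multi_indices (others S s) (npnt S). \<forall>as<ncomp S s.
           inactive_matrix S \<theta> s \<beta> $$ (lex_pos (others S s) (npnt S) i, as) =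
             inactive_contraction S \<theta> s \<beta> as i)) \<and>
     Psi_matrix S \<theta> s \<in> carrier_mat (num_points S {..<dims S}) (rankA S * npnt S s * ncomp S s) \<and>
     sensitivity_matrix S \<theta> s \<in> carrier_mat (rankA S * npnt S s * ncomp S s) (npar S s) \<and>
     jacobian_block S \<theta> s \<in> carrier_mat (num_points S {..<dims S}) (npar S s) \<and>
     jacobian_block S \<theta> s = Psi_matrix S \<theta> s * sensitivity_matrix S \<theta> s"
proof (intro allI impI conjI ballI)
  fix s assume s: "s < dims S"
  show Psi: "Psi_matrix S \<theta> s \<in>
      carrier_mat (num_points S {..<dims S}) (rankA S * npnt S s * ncomp S s)"
    by (simp add: Psi_matrix_def Let_def mult.assoc)
  show C: "sensitivity_matrix S \<theta> s \<in> carrier_mat (rankA S * npnt S s * ncomp S s) (npar S s)"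
    by (simp add: sensitivity_matrix_def Let_def mult.assoc)
  show J: "jacobian_block S \<theta> s \<in> carrier_mat (num_points S {..<dims S}) (npar S s)"
    by (simp add: jacobian_block_def)
  show "jacobian_block S \<theta> s = Psi_matrix S \<theta> s * sensitivity_matrix S \<theta> s"
  proof (rule eq_matI)
    fix p j
    assume "p < dim_row (Psi_matrix S \<theta> s * sensitivity_matrix S \<theta> s)"
      and "j < dim_col (Psi_matrix S \<theta> s * sensitivity_matrix S \<theta> s)"
    then have p: "p < num_points S {..<dims S}" and j: "j < npar S s" using Psi C by auto
    \<comment> \<open>Both entries reduce to the same double sum over \<beta> and the active
      component, at the grid index decoded from \<open>p\<close>.\<close>
    show "jacobian_block S \<theta> s $$ (p, j) = (Psi_matrix S \<theta> s * sensitivity_matrix S \<theta> s) $$ (p, j)"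
      using jacobian_block_index[OF assms(2-6) s p j] Psi_sensitivity_index[OF s p j]
      by (simp add: sum_deriv_factors[OF s])
  qed (use Psi C J in auto)
qed (simp_all add: inactive_matrix_dim inactive_matrix_index)

end
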